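(* Let $a,b,c,d\ge0$, not all zero, with $a+c=b+d$, and let $O=(e(i,t))_{i\in\mathbb Z,t\in\mathbb N}\sim\overline P^8_\infty=\mathcal L\left(\mathrm{PM}(1/2);\frac{a}{a+c},\frac{b}{b+d}\right)$. Let $N\ge1$ and let $S_N$ be any copy in $\overline K_\infty$ of the graph $K_N$ rotated by an angle $-\pi/4$. Then the restriction of $O$ to the edges of $S_N$, rotated by an angle $\pi/4$ (so seen as an orientation of $K_N$), has law $P^8_N$.
   Context: $\mathbb N=\{0,1,2,\dots\}$. Infinite graph $\overline K_\infty$: edges are indexed by $(i,t)\in\mathbb Z\times\mathbb N$ ($t$ increases downwards); internal vertices are indexed by the pairs $(i,t)\in\mathbb Z\times\mathbb N$ with $i+t$ even, and the vertex $(i,t)$ is incident to the edges $(i,t)$ (upper left), $(i+1,t)$ (upper right), $(i,t+1)$ (lower left), $(i+1,t+1)$ (lower right). $e(i,t)=1$ if edge $(i,t)$ is oriented upwards, $e(i,t)=0$ if downwards. The law $\mathcal L(\mu;p,r)$, for $\mu$ a probability measure on $\{0,1\}^{\mathbb Z}$ and $p,r\in[0,1]$: $(e(i,0))_{i\in\mathbb Z}\sim\mu$; and $(e(\cdot,t))_{t\ge0}$ is a Markov chain such that, given line $t$, independently for all $i\in\mathbb Z$ with $i+t$ even, the pair $(e(i,t+1),e(i+1,t+1))$ depends only on $(e(i,t),e(i+1,t))$, with, for $k\in\{0,1\}$: $(k,k)\mapsto(k,k)$ with probability $r$ and $(k,k)\mapsto(1-k,1-k)$ with probability $1-r$; $(k,1-k)\mapsto(1-k,k)$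 with probability $p$ and $(k,1-k)\mapsto(k,1-k)$ with probability $1-p$. $\mathrm{PM}(1/2)$ is the law of i.i.d. Bernoulli$(1/2)$ variables indexed by $\mathbb Z$. The graph $K_N$: the $N\times N$ square grid with internal vertices $(m,n)$, $0\le m,n\le N-1$ ($m$ horizontal, increasing to the right; $n$ vertical, increasing upwards), where every internal vertex has four edges (left, right, top, bottom), neighbouring internal vertices sharing an edge and the $4N$ remaining boundary edges being external ($2N^2+2N$ edges in total). $\Omega^8_N$ is the set of orientations of its edges with an even number of incoming edges at every internal vertex. The local weight of a vertex is: $a$ if both horizontal edges point right and both vertical edges point up, or both horizontal edges point left and both vertical edges point down; $b$ if horizontal edges both point right and vertical edges both point down, or horizontal both left and vertical both up; $c$ if both horizontal edges are incoming and both vertical edges outgoing, or the converse; $d$ if all four edges are incoming or all four are outgoing. $W(O)$ is the product of the local weights, and $P^8_N(O)=W(O)/\sum_{O'\in\Omega^8_N}W(O')$ (free boundary condition). Copy $S_N$ of $K_N$ rotated by $-\pi/4$: given $(i_0,t_0)\in\mathbb Z\times\mathbb N$ with $i_0+t_0$ even and $t_0\ge N-1$, vertex $(m,n)$ of $K_N$ corresponds to the vertex $(I,T)=(i_0+m+n,\,t_0+m-n)$ of $\overline K_\infty$, and its left, top, bottom, right edges correspond respectively to the edges $(I,T)$, $(I+1,T)$, $(I,T+1)$, $(I+1,T+1)$ (upper left, upper right, lower left, lower right). Under the rotation, a horizontal edge of $K_N$ points left iff $e=1$ on the corresponding edge, and a vertical edge of $K_N$ points up iff $e=1$ on the corresponding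 edge. *)

theory Defs
  imports "HOL-Probability.Probability"
begin

section \<open>Random orientations of the infinite graph\<close>

text \<open>The edge \<open>(i, t)\<close> of the infinite graph is an element of \<open>int \<times> nat\<close>. An orientation of the graph
  is a function \<open>int \<times> nat \<Rightarrow> bool\<close>, a line is a function \<open>int \<Rightarrow> bool\<close>; the value \<open>True\<close> stands for
  \<open>1\<close>, that is, for an edge that is oriented upwards.\<close>

definition line_space :: "(int \<Rightarrow> bool) measure" where
  "line_space = PiM UNIV (\<lambda>_. count_space UNIV)"

definition orientation_space :: "(int \<times> nat \<Rightarrow> bool) measure" where
  "orientation_space = PiM UNIV (\<lambda>_. count_space UNIV)"

definition PM :: "real \<Rightarrow> (int \<Rightarrow> bool) measure" where
  "PM q = PiM UNIV (\<lambda>_. measure_pmf (bernoulli_pmf q))"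

definition vertex_pmf :: "real \<Rightarrow> real \<Rightarrow> bool \<Rightarrow> bool \<Rightarrow> (bool \<times> bool) pmf" where
  "vertex_pmf p r k l =
     (if k = l
      then map_pmf (\<lambda>keep. if keep then (k, k) else (\<not> k, \<not> k)) (bernoulli_pmf r)
      else map_pmf (\<lambda>swap. if swap then (\<not> k, k) else (k, \<not> k)) (bernoulli_pmf p))"

text \<open>The conditional law of line \<open>t + 1\<close> given that line \<open>t\<close> is \<open>x\<close>: the vertices \<open>(i, t)\<close>, with
  \<open>i + t\<close> even, independently draw the values of their lower edges \<open>(i, t + 1)\<close> and \<open>(i + 1, t + 1)\<close>.\<close>

definition line_kernel :: "real \<Rightarrow> real \<Rightarrow> nat \<Rightarrow> (int \<Rightarrow> bool) \<Rightarrow> (int \<Rightarrow> bool) measure" where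
  "line_kernel p r t x =
     distr (PiM {i. even (i + int t)} (\<lambda>i. measure_pmf (vertex_pmf p r (x i) (x (i + 1)))))
       line_space
       (\<lambda>z j. if even (j + int t) then fst (z j) else snd (z (j - 1)))"

text \<open>The law of the Markov chain of lines with initial law \<open>\<mu>\<close> is the measure given by the
  Ionescu-Tulcea theorem; it lives on \<open>nat \<Rightarrow> int \<Rightarrow> bool\<close>, with the time as first argument.
  In \<open>chain_step\<close>, the argument \<open>\<omega>\<close> is the history of the lines before the given time.\<close>

definition chain_step ::
    "(int \<Rightarrow> bool) measure \<Rightarrow> real \<Rightarrow> real \<Rightarrow> nat \<Rightarrow> (nat \<Rightarrow> int \<Rightarrow> bool) \<Rightarrow> (int \<Rightarrow> bool) measure" where
  "chain_step \<mu> p r s \<omega> = (case s of 0 \<Rightarrow> \<mu> | Suc t \<Rightarrow> line_kernel p r t (\<omega> t))"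

definition chain_measure ::
    "(int \<Rightarrow> bool) measure \<Rightarrow> real \<Rightarrow> real \<Rightarrow> (nat \<Rightarrow> int \<Rightarrow> bool) measure" where
  "chain_measure \<mu> p r =
     projective_family.lim UNIV
       (Ionescu_Tulcea.CI (chain_step \<mu> p r) (\<lambda>_. line_space)) (\<lambda>_. line_space)"

definition chain_law ::
    "(int \<Rightarrow> bool) measure \<Rightarrow> real \<Rightarrow> real \<Rightarrow> (int \<times> nat \<Rightarrow> bool) measure" where
  "chain_law \<mu> p r = distr (chain_measure \<mu> p r) orientation_space (\<lambda>\<omega> (i, t). \<omega> t i)"

lemma space_line_space [simp]: "space line_space = UNIV"
  by (simp add: line_space_def space_PiM)

lemma measurable_line_component [measurable]:
  "(\<lambda>x. x i) \<in> measurable line_space (count_space UNIV)"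
  unfolding line_space_def by (rule measurable_component_singleton) simp

lemma measurable_vertex_product:
  "(\<lambda>x. PiM I (\<lambda>i. measure_pmf (vertex_pmf p r (x i) (x (i + 1)))))
     \<in> measurable line_space (subprob_algebra (PiM I (\<lambda>_. count_space UNIV)))"
proof (rule measurable_subprob_algebra_generated[OF sets_PiM Int_stable_prod_algebra prod_algebra_sets_into_space])
  fix x :: "int \<Rightarrow> bool"
  show "subprob_space (PiM I (\<lambda>i. measure_pmf (vertex_pmf p r (x i) (x (i + 1)))))"
    by (intro prob_space_imp_subprob_space prob_space_PiM) unfold_locales
  show "sets (PiM I (\<lambda>i. measure_pmf (vertex_pmf p r (x i) (x (i + 1)))))
      = sets (PiM I (\<lambda>_. count_space (UNIV :: (bool \<times> bool) set)))"
    by (intro sets_PiM_cong) auto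
next
  have prob: "prob_space (PiM I (\<lambda>i. measure_pmf (vertex_pmf p r (x i) (x (i + 1)))))" for x
    by (intro prob_space_PiM) unfold_locales
  have space: "space (PiM I (\<lambda>i. measure_pmf (vertex_pmf p r (x i) (x (i + 1)))))
      = (\<Pi>\<^sub>E i\<in>I. space (count_space UNIV))" for x
    by (simp add: space_PiM)
  show "(\<lambda>x. emeasure (PiM I (\<lambda>i. measure_pmf (vertex_pmf p r (x i) (x (i + 1)))))
        (\<Pi>\<^sub>E i\<in>I. space (count_space UNIV))) \<in> borel_measurable line_space"
    using prob_space.emeasure_space_1[OF prob] by (simp add: space)
next
  fix A assume "A \<in> prod_algebra I (\<lambda>_. count_space (UNIV :: (bool \<times> bool) set))"
  then obtain J E where J: "A = prod_emb I (\<lambda>_. count_space UNIV) J (PiE J E)"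
      "finite J" "J \<subseteq> I"
    by (auto elim!: prod_algebraE)
  have "emeasure (PiM I (\<lambda>i. measure_pmf (vertex_pmf p r (x i) (x (i + 1))))) A
      = (\<Prod>j\<in>J. emeasure (measure_pmf (vertex_pmf p r (x j) (x (j + 1)))) (E j))" for x
  proof -
    interpret product_prob_space "\<lambda>i. measure_pmf (vertex_pmf p r (x i) (x (i + 1)))" I
      by unfold_locales
    have "A = prod_emb I (\<lambda>i. measure_pmf (vertex_pmf p r (x i) (x (i + 1)))) J (PiE J E)"
      by (simp add: J prod_emb_def)
    then show ?thesis
      using J by (simp add: emeasure_PiM_emb)
  qed
  moreover have "(\<lambda>x. emeasure (measure_pmf (vertex_pmf p r (x j) (x (j + 1)))) (E j))
      \<in> borel_measurable line_space" for j
  proof -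
    have "(\<lambda>x. (x j, x (j + 1))) \<in> measurable line_space (count_space UNIV \<Otimes>\<^sub>M count_space UNIV)"
      by measurable
    then have "(\<lambda>x. (x j, x (j + 1))) \<in> measurable line_space (count_space UNIV)"
      by (simp add: pair_measure_countable)
    from measurable_compose[OF this, of "\<lambda>(k, l). emeasure (measure_pmf (vertex_pmf p r k l)) (E j)" borel]
    show ?thesis by simp
  qed
  ultimately show "(\<lambda>x. emeasure (PiM I (\<lambda>i. measure_pmf (vertex_pmf p r (x i) (x (i + 1))))) A)
      \<in> borel_measurable line_space"
    by simp
qed

lemma measurable_read_line:
  "(\<lambda>z j. if even (j + int t) then fst (z j) else snd (z (j - 1)))
     \<in> measurable (PiM {i. even (i + int t)} (\<lambda>_. count_space (UNIV :: (bool \<times> bool) set))) line_space"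
  unfolding line_space_def
proof (rule measurable_PiM_single')
  fix j :: int
  let ?I = "{i. even (i + int t)}" and ?S = "count_space (UNIV :: (bool \<times> bool) set)"
  have comp: "(\<lambda>z. f (z i)) \<in> measurable (PiM ?I (\<lambda>_. ?S)) (count_space UNIV)"
    if "even (i + int t)" for i and f :: "bool \<times> bool \<Rightarrow> bool"
    using measurable_compose[OF measurable_component_singleton[of i ?I "\<lambda>_. ?S"], of f] that by simp
  show "(\<lambda>z. if even (j + int t) then fst (z j) else snd (z (j - 1)))
      \<in> measurable (PiM ?I (\<lambda>_. ?S)) (count_space UNIV)"
  proof (cases "even (j + int t)")
    case True then show ?thesis using comp[of j fst] by simp
  next
    case False
    then have "even (j - 1 + int t)" by presburger
    with False show ?thesis using comp[of "j - 1" snd] by simp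
  qed
qed (simp add: space_PiM)

lemma measurable_line_kernel [measurable]:
  "line_kernel p r t \<in> measurable line_space (subprob_algebra line_space)"
  unfolding line_kernel_def[abs_def]
  using measurable_compose[OF measurable_vertex_product measurable_distr[OF measurable_read_line]] .

lemma prob_space_line_kernel: "prob_space (line_kernel p r t x)"
  unfolding line_kernel_def
proof (rule prob_space.prob_space_distr)
  show "prob_space (PiM {i. even (i + int t)} (\<lambda>i. measure_pmf (vertex_pmf p r (x i) (x (i + 1)))))"
    by (intro prob_space_PiM) unfold_locales
  have "sets (PiM {i. even (i + int t)} (\<lambda>i. measure_pmf (vertex_pmf p r (x i) (x (i + 1)))))
      = sets (PiM {i. even (i + int t)} (\<lambda>_. count_space (UNIV :: (bool \<times> bool) set)))"
    by (intro sets_PiM_cong) auto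
  then show "(\<lambda>z j. if even (j + int t) then fst (z j) else snd (z (j - 1)))
      \<in> measurable (PiM {i. even (i + int t)} (\<lambda>i. measure_pmf (vertex_pmf p r (x i) (x (i + 1))))) line_space"
    using measurable_read_line[of t] measurable_cong_sets by blast
qed

lemma sets_PM [simp]: "sets (PM q) = sets line_space"
  unfolding PM_def line_space_def by (intro sets_PiM_cong) auto

lemma prob_space_PM: "prob_space (PM q)"
  unfolding PM_def by (intro prob_space_PiM) unfold_locales

lemma Ionescu_Tulcea_chain_step:
  assumes "prob_space \<mu>" and sets: "sets \<mu> = sets line_space"
  shows "Ionescu_Tulcea (chain_step \<mu> p r) (\<lambda>_. line_space)"
proof (rule Ionescu_Tulcea.intro)
  fix s
  show "chain_step \<mu> p r s \<in> measurable (PiM {0..<s} (\<lambda>_. line_space)) (subprob_algebra line_space)"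
  proof (cases s)
    case 0
    have "\<mu> \<in> space (subprob_algebra line_space)"
      using assms by (simp add: space_subprob_algebra prob_space_imp_subprob_space)
    then show ?thesis by (simp add: 0 chain_step_def[abs_def])
  next
    case (Suc t)
    have "(\<lambda>\<omega>. \<omega> t) \<in> measurable (PiM {0..<s} (\<lambda>_. line_space)) line_space"
      by (rule measurable_component_singleton) (simp add: Suc)
    from measurable_compose[OF this measurable_line_kernel]
    show ?thesis by (simp add: Suc chain_step_def[abs_def])
  qed
  fix \<omega>
  show "prob_space (chain_step \<mu> p r s \<omega>)"
    using assms prob_space_line_kernel by (simp add: chain_step_def split: nat.split)
qed

lemma measurable_read_chain:
  "(\<lambda>\<omega> (i, t). \<omega> t i) \<in> measurable (PiM UNIV (\<lambda>_. line_space)) orientation_space"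
  unfolding orientation_space_def
proof (rule measurable_PiM_single')
  fix e :: "int \<times> nat"
  show "(\<lambda>\<omega>. (case e of (i, t) \<Rightarrow> \<omega> t i)) \<in> measurable (PiM UNIV (\<lambda>_. line_space)) (count_space UNIV)"
    by (cases e) (auto intro!: measurable_compose[OF measurable_component_singleton])
qed (simp add: space_PiM)

lemma prob_space_chain_law:
  assumes "prob_space \<mu>" and "sets \<mu> = sets line_space"
  shows "prob_space (chain_law \<mu> p r)"
proof -
  interpret Ionescu_Tulcea "chain_step \<mu> p r" "\<lambda>_. line_space"
    by (rule Ionescu_Tulcea_chain_step[OF assms])
  have "prob_space (chain_measure \<mu> p r)"
  proof
    have "emeasure PF.lim (prod_emb UNIV (\<lambda>_. line_space) {} {\<lambda>_. undefined}) = emeasure (CI {}) {\<lambda>_. undefined}"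
      by (rule lim) (auto simp: sets_PiM_empty)
    moreover have "emeasure (CI {}) {\<lambda>_. undefined} = 1"
      using prob_space.emeasure_space_1[OF PF.prob_space_P[of "{}"]]
      by (simp add: CI_def space_PiM)
    moreover have "prod_emb UNIV (\<lambda>_. line_space) {} {\<lambda>_. undefined} = space PF.lim"
      by (auto simp: prod_emb_def space_PiM)
    ultimately show "emeasure (chain_measure \<mu> p r) (space (chain_measure \<mu> p r)) = 1"
      by (simp add: chain_measure_def)
  qed
  moreover have "sets (chain_measure \<mu> p r) = sets (PiM UNIV (\<lambda>_. line_space))"
    by (simp add: chain_measure_def)
  ultimately show ?thesis
    unfolding chain_law_def using measurable_read_chain measurable_cong_sets
    by (blast intro: prob_space.prob_space_distr)
qed


section \<open>The eight-vertex model on the square grid\<close>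

text \<open>For the internal vertex \<open>(m, n)\<close>, the left and right edges are \<open>Hor m n\<close> and \<open>Hor (m + 1) n\<close>,
  the bottom and top edges are \<open>Ver m n\<close> and \<open>Ver m (n + 1)\<close>. In an orientation of the grid, \<open>True\<close>
  means that a horizontal edge points right, or that a vertical edge points up.\<close>

datatype grid_edge = Hor nat nat | Ver nat nat

definition left_edge :: "nat \<times> nat \<Rightarrow> grid_edge" where
  "left_edge = (\<lambda>(m, n). Hor m n)"

definition right_edge :: "nat \<times> nat \<Rightarrow> grid_edge" where
  "right_edge = (\<lambda>(m, n). Hor (m + 1) n)"

definition bottom_edge :: "nat \<times> nat \<Rightarrow> grid_edge" where
  "bottom_edge = (\<lambda>(m, n). Ver m n)"

definition top_edge :: "nat \<times> nat \<Rightarrow> grid_edge" where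
  "top_edge = (\<lambda>(m, n). Ver m (n + 1))"

definition grid_vertices :: "nat \<Rightarrow> (nat \<times> nat) set" where
  "grid_vertices N = {..<N} \<times> {..<N}"

definition grid_edges :: "nat \<Rightarrow> grid_edge set" where
  "grid_edges N = (\<Union>v\<in>grid_vertices N. {left_edge v, right_edge v, bottom_edge v, top_edge v})"

definition grid_orientations :: "nat \<Rightarrow> (grid_edge \<Rightarrow> bool) set" where
  "grid_orientations N = (grid_edges N \<rightarrow>\<^sub>E UNIV)"

definition in_degree :: "(grid_edge \<Rightarrow> bool) \<Rightarrow> nat \<times> nat \<Rightarrow> nat" where
  "in_degree \<theta> v =
     of_bool (\<theta> (left_edge v)) + of_bool (\<not> \<theta> (right_edge v))
     + of_bool (\<theta> (bottom_edge v)) + of_bool (\<not> \<theta> (top_edge v))"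

definition Omega8 :: "nat \<Rightarrow> (grid_edge \<Rightarrow> bool) set" where
  "Omega8 N = {\<theta> \<in> grid_orientations N. \<forall>v\<in>grid_vertices N. even (in_degree \<theta> v)}"

text \<open>The final value \<open>0\<close> in the local weight is never attained for \<open>\<theta> \<in> Omega8 N\<close>.\<close>

definition local_weight ::
    "real \<Rightarrow> real \<Rightarrow> real \<Rightarrow> real \<Rightarrow> (grid_edge \<Rightarrow> bool) \<Rightarrow> nat \<times> nat \<Rightarrow> real" where
  "local_weight a b c d \<theta> v =
     (let L = \<theta> (left_edge v); R = \<theta> (right_edge v); B = \<theta> (bottom_edge v); T = \<theta> (top_edge v) in
      if (L \<and> R \<and> B \<and> T) \<or> (\<not> L \<and> \<not> R \<and> \<not> B \<and> \<not> T) then a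
      else if (L \<and> R \<and> \<not> B \<and> \<not> T) \<or> (\<not> L \<and> \<not> R \<and> B \<and> T) then b
      else if (L \<and> \<not> R \<and> \<not> B \<and> T) \<or> (\<not> L \<and> R \<and> B \<and> \<not> T) then c
      else if (L \<and> \<not> R \<and> B \<and> \<not> T) \<or> (\<not> L \<and> R \<and> \<not> B \<and> T) then d
      else 0)"

definition weight ::
    "real \<Rightarrow> real \<Rightarrow> real \<Rightarrow> real \<Rightarrow> nat \<Rightarrow> (grid_edge \<Rightarrow> bool) \<Rightarrow> real" where
  "weight a b c d N \<theta> = (\<Prod>v\<in>grid_vertices N. local_weight a b c d \<theta> v)"

text \<open>The eight-vertex measure, seen as a measure on all orientations that gives no mass to the
  complement of \<open>Omega8 N\<close>.\<close>

definition P8 ::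
    "real \<Rightarrow> real \<Rightarrow> real \<Rightarrow> real \<Rightarrow> nat \<Rightarrow> (grid_edge \<Rightarrow> bool) measure" where
  "P8 a b c d N =
     point_measure (grid_orientations N)
       (\<lambda>\<theta>. ennreal (if \<theta> \<in> Omega8 N
                       then weight a b c d N \<theta> / (\<Sum>\<theta>'\<in>Omega8 N. weight a b c d N \<theta>')
                       else 0))"


section \<open>Rotated copies of the grid in the infinite graph\<close>

text \<open>The edge of the infinite graph that corresponds to an edge of the grid, in the copy attached to
  \<open>(i0, t0)\<close>. The lemma below relates this closed form to the correspondence between vertices.\<close>

fun copy_edge :: "int \<Rightarrow> nat \<Rightarrow> grid_edge \<Rightarrow> int \<times> nat" where
  "copy_edge i0 t0 (Hor m n) = (i0 + int m + int n, t0 + m - n)"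
| "copy_edge i0 t0 (Ver m n) = (i0 + int m + int n, t0 + 1 + m - n)"

lemma copy_edge_vertex:
  assumes "v \<in> grid_vertices N" and "N - 1 \<le> t0" and "v = (m, n)"
    and "I = i0 + int m + int n" and "T = t0 + m - n"
  shows "int T = int t0 + int m - int n"
    and "copy_edge i0 t0 (left_edge v) = (I, T)"
    and "copy_edge i0 t0 (top_edge v) = (I + 1, T)"
    and "copy_edge i0 t0 (bottom_edge v) = (I, T + 1)"
    and "copy_edge i0 t0 (right_edge v) = (I + 1, T + 1)"
  using assms
  by (auto simp: grid_vertices_def left_edge_def top_edge_def bottom_edge_def right_edge_def)

text \<open>An edge with value \<open>True\<close> in the infinite graph gives a horizontal edge that points left, or a
  vertical edge that points up.\<close>

definition rotated_restriction ::
    "int \<Rightarrow> nat \<Rightarrow> nat \<Rightarrow> (int \<times> nat \<Rightarrow> bool) \<Rightarrow> grid_edge \<Rightarrow> bool" where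
  "rotated_restriction i0 t0 N e =
     (\<lambda>g\<in>grid_edges N. case g of Hor m n \<Rightarrow> \<not> e (copy_edge i0 t0 g) | Ver m n \<Rightarrow> e (copy_edge i0 t0 g))"

end

theory Submission
  imports Defs
begin

text \<open>Since \<open>a + c = b + d\<close>, dividing the local weights by \<open>a + c\<close> turns them into the transition
  probabilities of the vertices. Running the chain over the finite past cone of the copy, started from
  fair bits, the orientation of the cone has probability a power of \<open>1/2\<close> times the product of the
  vertex weights. The transition at a vertex is doubly stochastic, so a topmost vertex can be summed out:
  its lower edges become fresh fair bits. Peeling off in this way the part of the cone above the copy
  keeps the product form, so the law on the copy is proportional to the eight-vertex weight.\<close>

section \<open>Markov property and cylinder probabilities\<close>

text \<open>One step of the chain, for a past event \<open>X\<close> on which the kernel gives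
  \<open>B\<close> the constant mass \<open>q\<close>. Cylinders fix all the edges that the kernel
  reads, so this case suffices and the integral over the past collapses to a product.\<close>

lemma (in Ionescu_Tulcea) emeasure_lim_Suc:
  assumes X[measurable]: "X \<in> sets (PiM {0..<n} M)" and B[measurable]: "B \<in> sets (M n)"
    and q: "\<And>\<omega>. \<omega> \<in> X \<Longrightarrow> emeasure (P n \<omega>) B = q"
  shows "emeasure PF.lim {\<omega> \<in> space (PiM UNIV M). restrict \<omega> {0..<n} \<in> X \<and> \<omega> n \<in> B}
    = emeasure PF.lim {\<omega> \<in> space (PiM UNIV M). restrict \<omega> {0..<n} \<in> X} * q"
proof -
  let ?u = "\<lambda>_. undefined"
  \<comment> \<open>The event as a set of histories of length \<open>Suc n\<close>, so that a finite
    marginal of the limit measure sees it.\<close>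
  define Y where "Y = {\<omega> \<in> space (PiM {0..<Suc n} M). restrict \<omega> {0..<n} \<in> X \<and> \<omega> n \<in> B}"
  have [measurable]: "(\<lambda>\<omega>. restrict \<omega> {0..<n}) \<in> measurable (PiM {0..<Suc n} M) (PiM {0..<n} M)"
    by (rule measurable_restrict_subset) auto
  have Y: "Y \<in> sets (PiM {0..<Suc n} M)"
    unfolding Y_def by measurable
  have emb_C: "emeasure PF.lim (PF.emb UNIV {0..<k} Z) = emeasure (C 0 k ?u) Z"
    if "Z \<in> sets (PiM {0..<k} M)" for k Z
    using that sets.sets_into_space[OF that]
    by (simp add: lim emeasure_CI[OF subset_refl] prod_emb_id space_PiM)
  have X_space: "X \<subseteq> space (PiM {0..<n} M)"
    using X by (rule sets.sets_into_space)
  have "{\<omega> \<in> space (PiM UNIV M). restrict \<omega> {0..<n} \<in> X \<and> \<omega> n \<in> B} = PF.emb UNIV {0..<Suc n} Y"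
    by (auto simp: Y_def prod_emb_def space_PiM PiE_iff extensional_def Int_absorb1 restrict_restrict)
  also have "emeasure PF.lim \<dots> = emeasure (C 0 (Suc n) ?u) Y"
    by (rule emb_C[OF Y])
  \<comment> \<open>\<open>C 0 (Suc n)\<close> draws a history from \<open>C 0 n\<close> and appends
    one coordinate by \<open>eP n\<close>.\<close>
  also have "\<dots> = (\<integral>\<^sup>+\<omega>. emeasure (eP n \<omega>) Y \<partial>C 0 n ?u)"
    using Y by (simp add: emeasure_bind[where N="PiM {0..<Suc n} M"] space_C measurable_cong_sets[OF sets_C])
  also have "\<dots> = (\<integral>\<^sup>+\<omega>. q * indicator X \<omega> \<partial>C 0 n ?u)"
  proof (rule nn_integral_cong)
    fix \<omega> assume "\<omega> \<in> space (C 0 n ?u)"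
    then have \<omega>: "\<omega> \<in> space (PiM {0..<n} M)" by (simp add: space_C)
    \<comment> \<open>A history of length \<open>n\<close> is \<open>undefined\<close> at
      \<open>n\<close>, so the restriction undoes the update there.\<close>
    have restr: "restrict (fun_upd \<omega> n x) {0..<n} = \<omega>" for x
      using \<omega> by (auto simp: space_PiM PiE_iff extensional_def restrict_def)
    have "(fun_upd \<omega> n) -` Y \<inter> space (M n) = (if \<omega> \<in> X then B else {})"
      using \<omega> sets.sets_into_space[OF B] unfolding Y_def
      by (auto simp: restr) (auto simp: space_PiM PiE_iff extensional_def)
    then show "emeasure (eP n \<omega>) Y = q * indicator X \<omega>"
      using q by (simp add: emeasure_eP[OF \<omega> Y])
  qed
  also have "\<dots> = q * emeasure (C 0 n ?u) X"
    by (simp add: nn_integral_cmult_indicator sets_C)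
  also have "emeasure (C 0 n ?u) X = emeasure PF.lim (PF.emb UNIV {0..<n} X)"
    by (rule emb_C[OF X, symmetric])
  also have "PF.emb UNIV {0..<n} X = {\<omega> \<in> space (PiM UNIV M). restrict \<omega> {0..<n} \<in> X}"
    by (auto simp: prod_emb_def space_PiM)
  finally show ?thesis
    by (subst mult.commute)
qed

section \<open>Cylinder events\<close>

definition cylinder :: "'a set \<Rightarrow> ('a \<Rightarrow> 'b) \<Rightarrow> ('a \<Rightarrow> 'b) set" where
  "cylinder F \<eta> = {e. \<forall>g\<in>F. e g = \<eta> g}"

lemma sets_cylinder_line [measurable]: "finite S \<Longrightarrow> cylinder S x \<in> sets line_space"
proof -
  assume "finite S"
  then have "{y \<in> space line_space. \<forall>i\<in>S. y i = x i} \<in> sets line_space"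
    by measurable
  then show ?thesis by (simp add: cylinder_def)
qed

lemma sets_cylinder_orientation [measurable]: 
  assumes "finite F" 
  shows "cylinder F \<eta> \<in> sets orientation_space"
proof -
  have [measurable]: "(\<lambda>e. e g) \<in> measurable orientation_space (count_space UNIV)" for g
    unfolding orientation_space_def by (rule measurable_component_singleton) simp
  have "{e \<in> space orientation_space. \<forall>g\<in>F. e g = \<eta> g} \<in> sets orientation_space"
    using assms by measurable
  then show ?thesis by (simp add: cylinder_def orientation_space_def space_PiM)
qed

text \<open>Transports the step to orientations: \<open>F\<close> consists of edges on earlier
  lines, \<open>S \<times> {n}\<close> of edges on line \<open>n\<close>. The premise on
  \<open>q\<close> must hold for every history that agrees with \<eta> on \<open>F\<close>, as it
  does when \<open>F\<close> contains the edges that the kernel reads.\<close>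

lemma emeasure_chain_law_cylinder_Suc:
  assumes \<mu>: "prob_space \<mu>" "sets \<mu> = sets line_space"
    and F: "finite F" "F \<subseteq> UNIV \<times> {..<n}" and S: "finite S"
    and q: "\<And>\<omega>. (\<And>i s. (i, s) \<in> F \<Longrightarrow> \<omega> s i = \<eta> (i, s))
      \<Longrightarrow> emeasure (chain_step \<mu> p r n \<omega>) (cylinder S (\<lambda>i. \<eta> (i, n))) = q"
  shows "emeasure (chain_law \<mu> p r) (cylinder (F \<union> S \<times> {n}) \<eta>)
    = emeasure (chain_law \<mu> p r) (cylinder F \<eta>) * q"
proof -
  interpret Ionescu_Tulcea "chain_step \<mu> p r" "\<lambda>_. line_space"
    by (rule Ionescu_Tulcea_chain_step[OF \<mu>])
  let ?L = "PiM UNIV (\<lambda>_::nat. line_space)"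
  have chain: "chain_measure \<mu> p r = PF.lim"
    by (simp add: chain_measure_def)
  have sets_lim: "sets PF.lim = sets ?L" by simp
  have chain_law: "emeasure (chain_law \<mu> p r) (cylinder G \<eta>)
      = emeasure PF.lim {\<omega> \<in> space ?L. \<forall>(i, s)\<in>G. \<omega> s i = \<eta> (i, s)}"
    if "finite G" for G
    unfolding chain_law_def chain
    using measurable_read_chain sets_cylinder_orientation[OF that]
    by (subst emeasure_distr)
       (auto simp: measurable_cong_sets[OF sets_lim refl] cylinder_def space_PiM intro!: arg_cong2[where f=emeasure])
  define X where "X = {\<omega> \<in> space (PiM {0..<n} (\<lambda>_. line_space)). \<forall>(i, s)\<in>F. \<omega> s i = \<eta> (i, s)}"
  have "Measurable.pred (PiM {0..<n} (\<lambda>_. line_space)) (\<lambda>\<omega>. \<omega> s i = \<eta> (i, s))" if "(i, s) \<in> F" for i s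
  proof -
    have "(\<lambda>\<omega>. \<omega> s) \<in> measurable (PiM {0..<n} (\<lambda>_. line_space)) line_space"
      using F that by (intro measurable_component_singleton) auto
    from measurable_compose[OF this measurable_line_component] show ?thesis by measurable
  qed
  then have X: "X \<in> sets (PiM {0..<n} (\<lambda>_. line_space))"
    unfolding X_def using F by (intro predE pred_intros_finite) auto
  \<comment> \<open>All edges of \<open>F\<close> lie on lines before \<open>n\<close>, so cutting
    the history at \<open>n\<close> loses nothing.\<close>
  have restrict_X: "restrict \<omega> {0..<n} \<in> X \<longleftrightarrow> (\<forall>(i, s)\<in>F. \<omega> s i = \<eta> (i, s))" for \<omega>
    using F by (auto simp: X_def space_PiM PiE_iff)
  have "emeasure (chain_step \<mu> p r n \<omega>) (cylinder S (\<lambda>i. \<eta> (i, n))) = q" if "\<omega> \<in> X" for \<omega>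
    using that by (intro q) (auto simp: X_def)
  from emeasure_lim_Suc[OF X sets_cylinder_line[OF S] this] 
  have "emeasure PF.lim {\<omega> \<in> space ?L. (\<forall>(i, s)\<in>F. \<omega> s i = \<eta> (i, s)) \<and> \<omega> n \<in> cylinder S (\<lambda>i. \<eta> (i, n))}
     = emeasure (chain_law \<mu> p r) (cylinder F \<eta>) * q"
    by (simp add: restrict_X chain_law F)
  moreover have "{\<omega> \<in> space ?L. (\<forall>(i, s)\<in>F. \<omega> s i = \<eta> (i, s)) \<and> \<omega> n \<in> cylinder S (\<lambda>i. \<eta> (i, n))}
     = {\<omega> \<in> space ?L. \<forall>(i, s)\<in>F \<union> S \<times> {n}. \<omega> s i = \<eta> (i, s)}"
    by (auto simp: cylinder_def)
  ultimately show ?thesis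
    using F S by (simp add: chain_law)
qed

lemma emeasure_PM_half_cylinder:
  assumes "finite S"
  shows "emeasure (PM (1/2)) (cylinder S x) = ennreal ((1/2) ^ card S)"
proof -
  interpret product_prob_space "\<lambda>_. measure_pmf (bernoulli_pmf (1/2))" "UNIV :: int set"
    by unfold_locales
  have "cylinder S x = {y \<in> space (PiM UNIV (\<lambda>_. measure_pmf (bernoulli_pmf (1/2)))). \<forall>i\<in>S. y i \<in> {x i}}"
    by (auto simp: cylinder_def space_PiM)
  then have "emeasure (PM (1/2)) (cylinder S x)
      = (\<Prod>i\<in>S. emeasure (measure_pmf (bernoulli_pmf (1/2))) {x i})"
    unfolding PM_def using assms by (simp only: emeasure_PiM_Collect[OF subset_UNIV] sets_measure_pmf UNIV_I Pow_UNIV)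
  also have "\<dots> = ennreal (1/2) ^ card S"
    by (simp only: emeasure_pmf_single pmf_bernoulli_half prod_constant)
  finally show ?thesis by (simp only: ennreal_power)
qed

text \<open>The edge set is made of complete lower pairs, so the event prescribes the pair drawn at
  each vertex of \<open>A\<close> and nothing else; independence of the draws gives the
  product.\<close>

lemma emeasure_line_kernel_cylinder:
  assumes A: "finite A" "\<And>i. i \<in> A \<Longrightarrow> even (i + int t)"
  shows "emeasure (line_kernel p r t x) (cylinder (A \<union> (\<lambda>i. i + 1) ` A) y)
    = (\<Prod>i\<in>A. ennreal (pmf (vertex_pmf p r (x i) (x (i + 1))) (y i, y (i + 1))))"
proof -
  let ?I = "{i. even (i + int t)}"
  let ?M = "\<lambda>i. measure_pmf (vertex_pmf p r (x i) (x (i + 1)))"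
  interpret product_prob_space ?M ?I
    by unfold_locales
  have "sets (PiM ?I ?M) = sets (PiM ?I (\<lambda>_. count_space (UNIV :: (bool \<times> bool) set)))"
    by (intro sets_PiM_cong) auto
  then have meas: "(\<lambda>z j. if even (j + int t) then fst (z j) else snd (z (j - 1))) \<in> measurable (PiM ?I ?M) line_space"
    using measurable_read_line[of t] measurable_cong_sets by blast
  \<comment> \<open>An index of \<open>A\<close> has the parity of the vertices of line
    \<open>t\<close> and reads the first entry of its own pair; its successor reads the second entry
    of the same pair.\<close>
  have "(\<lambda>z j. if even (j + int t) then fst (z j) else snd (z (j - 1))) -` cylinder (A \<union> (\<lambda>i. i + 1) ` A) y
      \<inter> space (PiM ?I ?M) = {z \<in> space (PiM ?I ?M). \<forall>i\<in>A. z i \<in> {(y i, y (i + 1))}}"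
    using A(2) by (auto simp: cylinder_def ball_Un prod_eq_iff)
  then have "emeasure (line_kernel p r t x) (cylinder (A \<union> (\<lambda>i. i + 1) ` A) y)
      = emeasure (PiM ?I ?M) {z \<in> space (PiM ?I ?M). \<forall>i\<in>A. z i \<in> {(y i, y (i + 1))}}"
    unfolding line_kernel_def using A(1) by (simp only: emeasure_distr[OF meas] sets_cylinder_line finite_UnI finite_imageI)
  also have "\<dots> = (\<Prod>i\<in>A. emeasure (?M i) {(y i, y (i + 1))})"
    using A by (intro emeasure_PiM_Collect) auto
  finally show ?thesis
    by (simp only: emeasure_pmf_single)
qed


section \<open>Product form on the past cone\<close>

definition vertex_weight :: "real \<Rightarrow> real \<Rightarrow> (int \<times> nat \<Rightarrow> bool) \<Rightarrow> int \<times> nat \<Rightarrow> real" where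
  "vertex_weight p r \<eta> = (\<lambda>(i, t).
     pmf (vertex_pmf p r (\<eta> (i, t)) (\<eta> (i + 1, t))) (\<eta> (i, t + 1), \<eta> (i + 1, t + 1)))"

definition upper_edges :: "int \<times> nat \<Rightarrow> (int \<times> nat) set" where
  "upper_edges = (\<lambda>(i, t). {(i, t), (i + 1, t)})"

definition lower_edges :: "int \<times> nat \<Rightarrow> (int \<times> nat) set" where
  "lower_edges = (\<lambda>(i, t). {(i, t + 1), (i + 1, t + 1)})"

definition edges_of :: "(int \<times> nat) set \<Rightarrow> (int \<times> nat) set" where
  "edges_of V = (\<Union>v\<in>V. upper_edges v \<union> lower_edges v)"

definition internal_vertices :: "(int \<times> nat) set" where
  "internal_vertices = {(i, t). even (i + int t)}"

text \<open>On one line the indices of internal vertices differ by even numbers, so their pairs of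
  consecutive edges do not overlap; on distinct lines the edges have distinct times.\<close>

lemma upper_edges_disjoint:
  "\<lbrakk>u \<in> internal_vertices; v \<in> internal_vertices; u \<noteq> v\<rbrakk> \<Longrightarrow> upper_edges u \<inter> upper_edges v = {}"
  by (auto simp: internal_vertices_def upper_edges_def)

lemma lower_edges_disjoint:
  "\<lbrakk>u \<in> internal_vertices; v \<in> internal_vertices; u \<noteq> v\<rbrakk> \<Longrightarrow> lower_edges u \<inter> lower_edges v = {}"
  by (auto simp: internal_vertices_def lower_edges_def)

lemma finite_vertex_edges [simp]: "finite (upper_edges v)" "finite (lower_edges v)"
  by (auto simp: upper_edges_def lower_edges_def split: prod.splits)

lemma finite_edges_of: "finite V \<Longrightarrow> finite (edges_of V)"
  by (simp add: edges_of_def)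

lemma vertex_weight_cong:
  assumes "\<And>g. g \<in> upper_edges v \<union> lower_edges v \<Longrightarrow> \<eta> g = \<zeta> g"
  shows "vertex_weight p r \<eta> v = vertex_weight p r \<zeta> v"
  using assms by (cases v) (simp add: vertex_weight_def upper_edges_def lower_edges_def)

lemma vertex_weight_fun_upd:
  "g \<notin> edges_of V \<Longrightarrow> v \<in> V \<Longrightarrow> vertex_weight p r (\<eta>(g := k)) v = vertex_weight p r \<eta> v"
  by (rule vertex_weight_cong) (auto simp: edges_of_def)

text \<open>The edges of \<open>F\<close> that no vertex of \<open>V\<close> emits are independent fair bits, and every vertex
  of \<open>V\<close> contributes its transition probability.\<close>

definition product_form :: "real \<Rightarrow> real \<Rightarrow> (int \<times> nat) set \<Rightarrow> (int \<times> nat) set \<Rightarrow> bool" where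
  "product_form p r V F \<longleftrightarrow> (\<forall>\<eta>. measure (chain_law (PM (1/2)) p r) (cylinder F \<eta>)
     = (1/2) ^ card (F - \<Union>(lower_edges ` V)) * (\<Prod>v\<in>V. vertex_weight p r \<eta> v))"

lemma prob_space_chain_law_PM: "prob_space (chain_law (PM q) p r)"
  by (intro prob_space_chain_law prob_space_PM sets_PM)

lemma sets_chain_law [simp]: "sets (chain_law \<mu> p r) = sets orientation_space"
  by (simp add: chain_law_def)

lemma measure_chain_law_cylinder_Suc:
  assumes F: "finite F" "F \<subseteq> UNIV \<times> {..<n}" and S: "finite S" and q: "\<And>\<eta>. q \<eta> \<ge> 0"
    and step: "\<And>\<omega> \<eta>. (\<And>i s. (i, s) \<in> F \<Longrightarrow> \<omega> s i = \<eta> (i, s))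
      \<Longrightarrow> emeasure (chain_step (PM (1/2)) p r n \<omega>) (cylinder S (\<lambda>i. \<eta> (i, n))) = ennreal (q \<eta>)"
  shows "measure (chain_law (PM (1/2)) p r) (cylinder (F \<union> S \<times> {n}) \<eta>)
    = measure (chain_law (PM (1/2)) p r) (cylinder F \<eta>) * q \<eta>"
proof -
  have "emeasure (chain_law (PM (1/2)) p r) (cylinder (F \<union> S \<times> {n}) \<eta>)
      = emeasure (chain_law (PM (1/2)) p r) (cylinder F \<eta>) * ennreal (q \<eta>)"
    by (rule emeasure_chain_law_cylinder_Suc[OF prob_space_PM sets_PM F S step])
  then show ?thesis
    using q by (simp add: measure_def enn2real_mult)
qed

text \<open>The step lemma is applied at time 0, where the past event is the whole space and
  \<open>chain_step\<close> is the initial law.\<close>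

lemma product_form_initial_line:
  assumes "finite S"
  shows "product_form p r {} (S \<times> {0})"
proof -
  interpret prob_space "chain_law (PM (1/2)) p r"
    by (rule prob_space_chain_law_PM)
  have "space (chain_law (PM (1/2)) p r) = UNIV"
    by (simp add: chain_law_def orientation_space_def space_PiM)
  then have "measure (chain_law (PM (1/2)) p r) (cylinder {} \<eta>) = 1" for \<eta> :: "int \<times> nat \<Rightarrow> bool"
    using prob_space by (simp add: cylinder_def)
  moreover have "measure (chain_law (PM (1/2)) p r) (cylinder ({} \<union> S \<times> {0}) \<eta>)
      = measure (chain_law (PM (1/2)) p r) (cylinder {} \<eta>) * (1/2) ^ card S" for \<eta>
    using assms by (intro measure_chain_law_cylinder_Suc) (auto simp: chain_step_def emeasure_PM_half_cylinder)
  ultimately show ?thesis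
    using assms by (simp add: product_form_def card_cartesian_product)
qed

text \<open>Running the chain one line further at the vertices of \<open>A\<close> multiplies in
  their weights. All the new edges are emitted by these vertices, so no fair bit is added.\<close>

lemma product_form_next_line:
  assumes V: "finite V" "V \<subseteq> UNIV \<times> {..<t}" and F: "finite F" "F \<subseteq> UNIV \<times> {..t}"
    and A: "finite A" "A \<times> {t} \<subseteq> internal_vertices" "\<Union>(upper_edges ` (A \<times> {t})) \<subseteq> F"
    and prod: "product_form p r V F"
  shows "product_form p r (V \<union> A \<times> {t}) (F \<union> \<Union>(lower_edges ` (A \<times> {t})))"
  unfolding product_form_def
proof
  fix \<eta> :: "int \<times> nat \<Rightarrow> bool"
  let ?S = "A \<union> (\<lambda>i. i + 1) ` A"
  have low: "\<Union>(lower_edges ` (A \<times> {t})) = ?S \<times> {Suc t}"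
    by (auto simp: lower_edges_def)
  have "measure (chain_law (PM (1/2)) p r) (cylinder (F \<union> ?S \<times> {Suc t}) \<eta>)
      = measure (chain_law (PM (1/2)) p r) (cylinder F \<eta>) * (\<Prod>i\<in>A. vertex_weight p r \<eta> (i, t))"
  proof (rule measure_chain_law_cylinder_Suc)
    show "F \<subseteq> UNIV \<times> {..<Suc t}" using F(2) by (simp add: lessThan_Suc_atMost)
    fix \<omega> :: "nat \<Rightarrow> int \<Rightarrow> bool" and \<eta> :: "int \<times> nat \<Rightarrow> bool"
    assume *: "\<And>i s. (i, s) \<in> F \<Longrightarrow> \<omega> s i = \<eta> (i, s)"
    \<comment> \<open>The upper edges of the new vertices lie in \<open>F\<close>, so the past
      cylinder already fixes what the kernel reads.\<close>
    have \<omega>: "\<omega> t i = \<eta> (i, t)" "\<omega> t (i + 1) = \<eta> (i + 1, t)" if "i \<in> A" for i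
      using A(3) that by (auto intro!: * simp: upper_edges_def)
    have "emeasure (chain_step (PM (1/2)) p r (Suc t) \<omega>) (cylinder ?S (\<lambda>i. \<eta> (i, Suc t)))
        = (\<Prod>i\<in>A. ennreal (pmf (vertex_pmf p r (\<omega> t i) (\<omega> t (i + 1))) (\<eta> (i, Suc t), \<eta> (i + 1, Suc t))))"
      using A by (simp add: chain_step_def emeasure_line_kernel_cylinder internal_vertices_def subset_iff)
    also have "\<dots> = (\<Prod>i\<in>A. ennreal (vertex_weight p r \<eta> (i, t)))"
      by (intro prod.cong) (simp_all add: vertex_weight_def \<omega>)
    also have "\<dots> = ennreal (\<Prod>i\<in>A. vertex_weight p r \<eta> (i, t))"
      by (intro prod_ennreal) (simp add: vertex_weight_def)
    finally show "emeasure (chain_step (PM (1/2)) p r (Suc t) \<omega>) (cylinder ?S (\<lambda>i. \<eta> (i, Suc t)))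
        = ennreal (\<Prod>i\<in>A. vertex_weight p r \<eta> (i, t))" .
  qed (use F A in \<open>auto simp: vertex_weight_def intro!: prod_nonneg\<close>)
  moreover have "(\<Prod>v\<in>V \<union> A \<times> {t}. vertex_weight p r \<eta> v)
      = (\<Prod>v\<in>V. vertex_weight p r \<eta> v) * (\<Prod>i\<in>A. vertex_weight p r \<eta> (i, t))"
  proof -
    have "(\<Prod>v\<in>A \<times> {t}. vertex_weight p r \<eta> v) = (\<Prod>i\<in>A. vertex_weight p r \<eta> (i, t))"
      by (rule prod.reindex_bij_witness[of _ "\<lambda>i. (i, t)" fst]) auto
    then show ?thesis
      using V A by (subst prod.union_disjoint) auto
  qed
  \<comment> \<open>Edges of \<open>F\<close> have time at most \<open>t\<close>, so the new lower
    edges, at time \<open>Suc t\<close>, are not among them.\<close>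
  moreover have "F \<union> ?S \<times> {Suc t} - \<Union>(lower_edges ` (V \<union> A \<times> {t})) = F - \<Union>(lower_edges ` V)"
    using F(2) unfolding image_Un Union_Un_distrib low by auto
  ultimately show "measure (chain_law (PM (1/2)) p r) (cylinder (F \<union> \<Union>(lower_edges ` (A \<times> {t}))) \<eta>)
      = (1/2) ^ card (F \<union> \<Union>(lower_edges ` (A \<times> {t})) - \<Union>(lower_edges ` (V \<union> A \<times> {t})))
        * (\<Prod>v\<in>V \<union> A \<times> {t}. vertex_weight p r \<eta> v)"
    using prod by (simp add: product_form_def low)
qed

text \<open>Every internal vertex that emits an upper edge of \<open>V\<close> is in
  \<open>V\<close>, so the chain can be run line by line while drawing only the vertices of
  \<open>V\<close>. The set \<open>F\<close> may exceed \<open>edges_of V\<close>.\<close>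

lemma product_form_past_closed:
  assumes V: "finite V" "V \<subseteq> internal_vertices"
    and closed: "\<And>u v. \<lbrakk>v \<in> V; u \<in> internal_vertices; lower_edges u \<inter> upper_edges v \<noteq> {}\<rbrakk> \<Longrightarrow> u \<in> V"
  obtains F where "finite F" "edges_of V \<subseteq> F" "product_form p r V F"
proof -
  define S where "S = fst ` edges_of V"
  have S: "finite S" using V by (simp add: S_def finite_edges_of)
  define W where "W t = {v \<in> V. snd v < t}" for t
  define F where "F t = S \<times> {0} \<union> \<Union>(lower_edges ` W t)" for t
  have upper_F: "g \<in> F (snd v)" if v: "v \<in> V" and g: "g \<in> upper_edges v" for g v
  proof -
    obtain i t where it: "v = (i, t)" "even (i + int t)"
      using v V(2) by (auto simp: internal_vertices_def)
    obtain j where j: "g = (j, t)" using g it by (auto simp: upper_edges_def)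
    show ?thesis
    proof (cases t)
      case 0
      have "g \<in> edges_of V" using v g by (auto simp: edges_of_def)
      then show ?thesis by (auto simp: F_def S_def j 0 intro: rev_image_eqI)
    next
      case (Suc s)
      \<comment> \<open>The emitter of \<open>g\<close> on the preceding line: it lies to the left
        of \<open>v\<close> if \<open>g\<close> is the upper left edge, to the right
        otherwise.\<close>
      let ?u = "(if j = i then i - 1 else i + 1, s)"
      have u: "?u \<in> internal_vertices" "g \<in> lower_edges ?u"
        using g it by (auto simp: internal_vertices_def lower_edges_def upper_edges_def Suc j)
      then have "lower_edges ?u \<inter> upper_edges v \<noteq> {}" using g by blast
      then have "?u \<in> V" using closed[OF v u(1)] by simp
      then show ?thesis using u by (auto simp: F_def W_def it Suc)
    qed
  qed
  have prod: "product_form p r (W t) (F t)" for t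
  proof (induction t)
    case 0
    show ?case using product_form_initial_line[OF S] by (simp add: W_def F_def)
  next
    case (Suc t)
    define A where "A = {i. (i, t) \<in> V}"
    have A: "finite A"
      using finite_imageI[OF V(1), of fst] by (rule finite_subset[rotated]) (auto simp: A_def intro: rev_image_eqI)
    have W: "W (Suc t) = W t \<union> A \<times> {t}"
      by (auto simp: W_def A_def less_Suc_eq)
    have "product_form p r (W t \<union> A \<times> {t}) (F t \<union> \<Union>(lower_edges ` (A \<times> {t})))"
    proof (rule product_form_next_line[OF _ _ _ _ A _ _ Suc.IH])
      show "\<Union>(upper_edges ` (A \<times> {t})) \<subseteq> F t"
        using upper_F[of "(_, t)"] by (auto simp: A_def)
      show "A \<times> {t} \<subseteq> internal_vertices"
        using V by (auto simp: A_def)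
      show "finite (W t)" "finite (F t)"
        using V S by (simp_all add: W_def F_def)
    qed (auto simp: W_def F_def lower_edges_def)
    then show ?case by (simp add: W F_def Un_assoc)
  qed
  \<comment> \<open>A time after all of \<open>V\<close>. For empty \<open>V\<close> the maximum is
    unspecified, but \<open>W T = V\<close> still holds.\<close>
  define T where "T = Suc (Max (snd ` V))"
  have T: "snd v < T" if "v \<in> V" for v
    using V(1) that by (auto simp: T_def less_Suc_eq_le intro!: Max_ge)
  then have "W T = V" by (auto simp: W_def)
  moreover have "edges_of V \<subseteq> F T"
  proof -
    have "W (snd v) \<subseteq> W T" if "v \<in> V" for v
      using T[OF that] by (auto simp: W_def)
    then have "F (snd v) \<subseteq> F T" if "v \<in> V" for v
      unfolding F_def using that by (intro Un_mono subset_refl Union_mono image_mono)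
    then have "upper_edges v \<subseteq> F T" if "v \<in> V" for v
      using upper_F that by blast
    moreover have "lower_edges v \<subseteq> F T" if "v \<in> V" for v
      using that by (auto simp: F_def \<open>W T = V\<close>)
    ultimately show ?thesis unfolding edges_of_def by (intro UN_least Un_least)
  qed
  moreover have "finite (F T)"
    using S V by (simp add: F_def \<open>W T = V\<close>)
  ultimately show thesis
    using prod[of T] by (intro that) auto
qed

section \<open>Peeling off edges and vertices\<close>

lemma measure_cylinder_split:
  assumes F: "finite F" "g \<notin> F"
  shows "measure (chain_law (PM q) p r) (cylinder F \<eta>)
    = (\<Sum>k\<in>UNIV. measure (chain_law (PM q) p r) (cylinder (insert g F) (\<eta>(g := k))))"
proof -
  interpret prob_space "chain_law (PM q) p r"
    by (rule prob_space_chain_law_PM)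
  have mem: "e \<in> cylinder (insert g F) (\<eta>(g := k)) \<longleftrightarrow> e \<in> cylinder F \<eta> \<and> e g = k" for e k
    using F(2) by (auto simp: cylinder_def)
  have "cylinder F \<eta> = (\<Union>k\<in>UNIV. cylinder (insert g F) (\<eta>(g := k)))"
    unfolding set_eq_iff UN_iff mem by blast
  also have "measure (chain_law (PM q) p r) \<dots>
      = (\<Sum>k\<in>UNIV. measure (chain_law (PM q) p r) (cylinder (insert g F) (\<eta>(g := k))))"
  proof (rule finite_measure_finite_Union)
    show "range (\<lambda>k. cylinder (insert g F) (\<eta>(g := k))) \<subseteq> events"
      using F(1) by (simp add: image_subset_iff sets_cylinder_orientation)
    show "disjoint_family (\<lambda>k. cylinder (insert g F) (\<eta>(g := k)))"
      unfolding disjoint_family_on_def disjoint_iff mem by blast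
  qed simp
  finally show ?thesis .
qed

text \<open>An edge of no vertex of \<open>V\<close> is one of the fair bits and enters no weight,
  so its two values contribute equally and one factor 1/2 cancels.\<close>

lemma product_form_remove_edge:
  assumes prod: "product_form p r V (insert g F)"
    and F: "finite F" "g \<notin> F" and g: "g \<notin> edges_of V"
  shows "product_form p r V F"
  unfolding product_form_def
proof
  fix \<eta> :: "int \<times> nat \<Rightarrow> bool"
  let ?L = "\<Union>(lower_edges ` V)"
  have "insert g F - ?L = insert g (F - ?L)"
    using g unfolding edges_of_def by blast
  then have card: "card (insert g F - ?L) = Suc (card (F - ?L))"
    using F by simp
  have weights: "(\<Prod>v\<in>V. vertex_weight p r (\<eta>(g := k)) v) = (\<Prod>v\<in>V. vertex_weight p r \<eta> v)" for k
    using g by (intro prod.cong refl vertex_weight_fun_upd)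
  have half: "measure (chain_law (PM (1/2)) p r) (cylinder (insert g F) (\<eta>(g := k)))
      = (1/2) ^ Suc (card (F - ?L)) * (\<Prod>v\<in>V. vertex_weight p r \<eta> v)" for k
    using prod unfolding product_form_def card weights[of k, symmetric] by blast
  show "measure (chain_law (PM (1/2)) p r) (cylinder F \<eta>)
      = (1/2) ^ card (F - ?L) * (\<Prod>v\<in>V. vertex_weight p r \<eta> v)"
    unfolding measure_cylinder_split[OF F] half by (simp add: UNIV_bool)
qed

lemma product_form_restrict_edges:
  assumes "product_form p r V F" "finite F" "edges_of V \<subseteq> F"
  shows "product_form p r V (edges_of V)"
proof -
  have fin: "finite (edges_of V)" "finite (F - edges_of V)"
    using assms(2,3) finite_subset by auto
  have remove: "product_form p r V (edges_of V)"
    if "finite H" "product_form p r V (edges_of V \<union> H)" "H \<inter> edges_of V = {}" for H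
    using that
  proof (induction H rule: finite_induct)
    case (insert g H)
    from insert.prems have g: "g \<notin> edges_of V" by blast
    have "product_form p r V (edges_of V \<union> H)"
      by (rule product_form_remove_edge[where g=g]) (use insert.prems insert.hyps fin(1) g in auto)
    with insert.prems(2) show ?case by (intro insert.IH) auto
  qed simp
  have "edges_of V \<union> (F - edges_of V) = F"
    using assms(3) by blast
  with assms(1) show ?thesis
    by (intro remove[OF fin(2)]) auto
qed

section \<open>Transition probabilities of a single vertex\<close>

lemma pmf_map_bernoulli:
  assumes "0 \<le> q" "q \<le> 1"
  shows "pmf (map_pmf f (bernoulli_pmf q)) z = q * of_bool (f True = z) + (1 - q) * of_bool (f False = z)"
  using assms by (simp add: map_pmf_def pmf_bind indicator_def of_bool_def)

lemma pmf_vertex_pmf: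
  assumes "0 \<le> p" "p \<le> 1" "0 \<le> r" "r \<le> 1"
  shows "pmf (vertex_pmf p r k l) (x, y) =
    (if k = l then if x \<noteq> y then 0 else if x = k then r else 1 - r
     else if x = y then 0 else if x = k then 1 - p else p)"
  using assms by (cases k; cases l; cases x; cases y) (simp_all add: vertex_pmf_def pmf_map_bernoulli)

text \<open>Double stochasticity, so that the uniform law on pairs of bits is invariant.\<close>

lemma sum_vertex_pmf_upper:
  assumes "0 \<le> p" "p \<le> 1" "0 \<le> r" "r \<le> 1"
  shows "(\<Sum>k\<in>UNIV. \<Sum>l\<in>UNIV. pmf (vertex_pmf p r k l) (x, y)) = 1"
  using assms by (cases x; cases y) (simp_all add: UNIV_bool pmf_vertex_pmf)

text \<open>By parity an upper edge of \<open>v\<close> is an upper edge of no other internal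
  vertex, so it could only meet \<open>V\<close> as a lower edge.\<close>

lemma upper_edges_Int_edges_of:
  assumes "v \<in> internal_vertices" "V \<subseteq> internal_vertices" "v \<notin> V"
    and "upper_edges v \<inter> \<Union>(lower_edges ` V) = {}"
  shows "upper_edges v \<inter> edges_of V = {}"
proof -
  have "upper_edges v \<inter> upper_edges w = {}" if "w \<in> V" for w
    using assms that by (intro upper_edges_disjoint) auto
  with assms(4) show ?thesis
    unfolding edges_of_def by blast
qed

text \<open>Removing a vertex that receives no edge from the others: its upper edges are summed out by double
  stochasticity, and its lower edges take over their role as independent fair bits.\<close>

lemma product_form_remove_vertex:
  assumes pr: "0 \<le> p" "p \<le> 1" "0 \<le> r" "r \<le> 1"
    and V: "finite V" "insert v V \<subseteq> internal_vertices" "v \<notin> V"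
    and F: "finite F" "edges_of (insert v V) \<subseteq> F"
    and initial: "upper_edges v \<inter> \<Union>(lower_edges ` V) = {}"
    and prod: "product_form p r (insert v V) F"
  shows "product_form p r V (F - upper_edges v)"
  unfolding product_form_def
proof
  fix \<eta> :: "int \<times> nat \<Rightarrow> bool"
  obtain i t where v: "v = (i, t)" by (cases v)
  let ?M = "chain_law (PM (1/2)) p r"
  let ?\<eta> = "\<lambda>k l. \<eta>((i, t) := k, (i + 1, t) := l)"
  let ?L = "\<Union>(lower_edges ` V)"
  have upper: "upper_edges v = {(i, t), (i + 1, t)}" and lower: "lower_edges v = {(i, t + 1), (i + 1, t + 1)}"
    by (simp_all add: v upper_edges_def lower_edges_def)
  \<comment> \<open>No remaining weight reads the upper edges of \<open>v\<close>, so summing over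
    them affects the weight of \<open>v\<close> alone.\<close>
  have "upper_edges v \<inter> edges_of V = {}"
    using V initial by (intro upper_edges_Int_edges_of) auto
  then have upd: "(\<Prod>w\<in>V. vertex_weight p r (?\<eta> k l) w) = (\<Prod>w\<in>V. vertex_weight p r \<eta> w)" for k l
    by (intro prod.cong refl) (simp add: upper vertex_weight_fun_upd[of _ V])
  have edges_v: "upper_edges v \<subseteq> F" "lower_edges v \<subseteq> F"
    using F by (auto simp: edges_of_def)
  have lower_disj: "lower_edges v \<inter> ?L = {}"
  proof -
    have "lower_edges v \<inter> lower_edges w = {}" if "w \<in> V" for w
      using V that by (intro lower_edges_disjoint) auto
    then show ?thesis by (simp add: Int_UN_distrib)
  qed
  have ul: "upper_edges v \<inter> lower_edges v = {}"
    by (auto simp: upper lower)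
  have card2: "card (upper_edges v) = 2" "card (lower_edges v) = 2"
    by (simp_all add: upper lower)
  \<comment> \<open>\<open>?G\<close> holds the edges that are free both before and after the
    removal. Two upper edges of \<open>v\<close> are free before it, two lower edges after it, so
    the power of 1/2 is unchanged.\<close>
  let ?G = "F - upper_edges v - lower_edges v - ?L"
  have "F - upper_edges v - ?L = ?G \<union> lower_edges v" "F - \<Union>(lower_edges ` insert v V) = ?G \<union> upper_edges v"
    using edges_v lower_disj ul initial by auto
  moreover have "card (?G \<union> lower_edges v) = card ?G + 2" "card (?G \<union> upper_edges v) = card ?G + 2"
    using F(1) by (subst card_Un_disjoint; auto simp: card2)+
  ultimately have card: "card (F - \<Union>(lower_edges ` insert v V)) = card (F - upper_edges v - ?L)"
    by simp
  have F': "insert (i + 1, t) (insert (i, t) (F - upper_edges v)) = F"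
    using edges_v by (auto simp: upper)
  have "measure ?M (cylinder (F - upper_edges v) \<eta>)
      = (\<Sum>k\<in>UNIV. measure ?M (cylinder (insert (i, t) (F - upper_edges v)) (\<eta>((i, t) := k))))"
    by (rule measure_cylinder_split) (simp_all add: F(1) upper)
  also have "\<dots> = (\<Sum>k\<in>UNIV. \<Sum>l\<in>UNIV. measure ?M (cylinder F (?\<eta> k l)))"
    by (rule sum.cong[OF refl], subst measure_cylinder_split[where g="(i + 1, t)"])
      (simp_all only: F', simp_all add: F(1) upper)
  also have "\<dots> = (\<Sum>k\<in>UNIV. \<Sum>l\<in>UNIV. (1/2) ^ card (F - \<Union>(lower_edges ` insert v V)) *
      (vertex_weight p r (?\<eta> k l) v * (\<Prod>w\<in>V. vertex_weight p r \<eta> w)))"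
    using prod V upd by (simp add: product_form_def)
  also have "\<dots> = (1/2) ^ card (F - upper_edges v - ?L) *
      (\<Sum>k\<in>UNIV. \<Sum>l\<in>UNIV. vertex_weight p r (?\<eta> k l) v) * (\<Prod>w\<in>V. vertex_weight p r \<eta> w)"
    unfolding card by (simp add: sum_distrib_left sum_distrib_right mult_ac)
  also have "(\<Sum>k\<in>UNIV. \<Sum>l\<in>UNIV. vertex_weight p r (?\<eta> k l) v) = 1"
    using sum_vertex_pmf_upper[OF pr] by (simp add: vertex_weight_def v)
  finally show "measure ?M (cylinder (F - upper_edges v) \<eta>)
      = (1/2) ^ card (F - upper_edges v - ?L) * (\<Prod>w\<in>V. vertex_weight p r \<eta> w)"
    by simp
qed

text \<open>\<open>R\<close> contains the emitters in \<open>V\<close> of its upper edges, so a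
  vertex of \<open>R\<close> of least time receives no edge from \<open>V\<close> and can be
  removed. The rest of \<open>R\<close> inherits the condition, which allows induction on its
  size.\<close>

lemma product_form_remove_initial:
  assumes pr: "0 \<le> p" "p \<le> 1" "0 \<le> r" "r \<le> 1"
    and "finite V" "V \<subseteq> internal_vertices" "finite F" "edges_of V \<subseteq> F" "product_form p r V F"
    and "R \<subseteq> V" "\<And>u v. \<lbrakk>v \<in> R; u \<in> V; lower_edges u \<inter> upper_edges v \<noteq> {}\<rbrakk> \<Longrightarrow> u \<in> R"
  shows "product_form p r (V - R) (edges_of (V - R))"
  using assms(5-)
proof (induction "card R" arbitrary: R V F)
  case 0
  \<comment> \<open>With nothing left to peel, the surplus edges of \<open>F\<close> are summed
    out.\<close>
  then have "R = {}" using finite_subset[OF 0(7,2)] by simp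
  with 0 show ?case using product_form_restrict_edges[of p r V F] by simp
next
  case (Suc n)
  have "finite R" "R \<noteq> {}" using Suc.hyps(2) finite_subset[OF Suc.prems(6,1)] by auto
  define v where "v = arg_min_on snd R"
  have v: "v \<in> R" "\<And>u. u \<in> R \<Longrightarrow> snd v \<le> snd u"
    unfolding v_def using \<open>finite R\<close> \<open>R \<noteq> {}\<close>
    by (auto intro: arg_min_if_finite(1) arg_min_least)
  have lower_v: "lower_edges u \<inter> upper_edges v = {}" if "u \<in> V" for u
  proof (rule ccontr)
    assume *: "lower_edges u \<inter> upper_edges v \<noteq> {}"
    then have "snd v \<le> snd u" using Suc.prems(7)[OF v(1) that] v(2) by blast
    \<comment> \<open>An edge emitted by \<open>u\<close> into \<open>v\<close> forces
      \<open>snd v = snd u + 1\<close>.\<close>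
    with * show False by (auto simp: lower_edges_def upper_edges_def split: prod.splits)
  qed
  have edges: "edges_of (V - {v}) \<subseteq> F - upper_edges v"
  proof -
    have "upper_edges v \<inter> edges_of (V - {v}) = {}"
      using lower_v Suc.prems(2,6) v(1) by (intro upper_edges_Int_edges_of) auto
    moreover have "edges_of (V - {v}) \<subseteq> edges_of V"
      unfolding edges_of_def by (intro UN_mono) auto
    ultimately show ?thesis using Suc.prems(4) by blast
  qed
  have V: "insert v (V - {v}) = V" using v(1) Suc.prems(6) by auto
  have initial: "upper_edges v \<inter> \<Union>(lower_edges ` (V - {v})) = {}"
    using lower_v by blast
  have prod: "product_form p r (V - {v}) (F - upper_edges v)"
    by (rule product_form_remove_vertex[OF pr _ _ _ _ _ initial])
      (use Suc.prems(1-5) in \<open>simp_all only: V, simp_all\<close>)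
  have card: "n = card (R - {v})"
    using Suc.hyps(2) v(1) \<open>finite R\<close> by simp
  have closed: "u \<in> R - {v}"
    if "w \<in> R - {v}" "u \<in> V - {v}" "lower_edges u \<inter> upper_edges w \<noteq> {}" for u w
  proof -
    have "u \<in> R"
      using that(1,2) by (intro Suc.prems(7)[OF _ _ that(3)]) simp_all
    with that(2) show ?thesis by simp
  qed
  have subsets: "V - {v} \<subseteq> internal_vertices" "R - {v} \<subseteq> V - {v}"
    using Suc.prems(2,6) by blast+
  have "product_form p r ((V - {v}) - (R - {v})) (edges_of ((V - {v}) - (R - {v})))"
    by (rule Suc.hyps(1)[OF card finite_Diff[OF Suc.prems(1)] subsets(1)
        finite_Diff[OF Suc.prems(3)] edges prod subsets(2) closed])
  moreover have "(V - {v}) - (R - {v}) = V - R" using v(1) by auto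
  ultimately show ?case by simp
qed

section \<open>The rotated copy of the grid\<close>

text \<open>The vertices of the copy in diagonal coordinates: the sum and the difference of
  \<open>i - i0\<close> and \<open>t - t0\<close> are \<open>2 * m\<close> and \<open>2 * n\<close>
  for the grid vertex \<open>(m, n)\<close>.\<close>

definition diamond :: "int \<Rightarrow> nat \<Rightarrow> nat \<Rightarrow> (int \<times> nat) set" where
  "diamond i0 t0 N = {(i, t). even (i + int t)
     \<and> 0 \<le> (i - i0) + (int t - int t0) \<and> (i - i0) + (int t - int t0) < 2 * int N
     \<and> 0 \<le> (i - i0) - (int t - int t0) \<and> (i - i0) - (int t - int t0) < 2 * int N}"

lemma product_form_diamond:
  assumes pr: "0 \<le> p" "p \<le> 1" "0 \<le> r" "r \<le> 1"
  shows "product_form p r (diamond i0 t0 N) (edges_of (diamond i0 t0 N))"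
proof -
  \<comment> \<open>Going up to an emitter changes the sum coordinate by 0 or -2 and the difference
    coordinate by +2 or 0. The two bounds kept here survive this, so \<open>V\<close> is closed
    towards the past.\<close>
  define V where "V = {(i, t). even (i + int t)
     \<and> (i - i0) + (int t - int t0) < 2 * int N \<and> 0 \<le> (i - i0) - (int t - int t0)}"
  \<comment> \<open>The part of the cone outside the copy. Going up also preserves each violated
    bound, so \<open>R\<close> can be peeled off.\<close>
  define R where "R = {(i, t) \<in> V. (i - i0) + (int t - int t0) < 0 \<or> 2 * int N \<le> (i - i0) - (int t - int t0)}"
  \<comment> \<open>Finiteness comes from the initial line: times are nonnegative, which bounds the
    indices on both sides.\<close>
  have "V \<subseteq> {i0 - int t0 .. i0 + int t0 + 2 * int N} \<times> {..t0 + N}"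
    by (auto simp: V_def)
  then have V: "finite V" "V \<subseteq> internal_vertices"
    by (auto intro: finite_subset simp: V_def internal_vertices_def)
  have past: "u \<in> V" if "v \<in> V" "u \<in> internal_vertices" "lower_edges u \<inter> upper_edges v \<noteq> {}" for u v
    using that by (auto simp: V_def internal_vertices_def lower_edges_def upper_edges_def)
  obtain F where F: "finite F" "edges_of V \<subseteq> F" "product_form p r V F"
    by (rule product_form_past_closed[OF V past])
  have R: "R \<subseteq> V"
    unfolding R_def by blast
  have "u \<in> R" if "v \<in> R" "u \<in> V" "lower_edges u \<inter> upper_edges v \<noteq> {}" for u v
    using that by (auto simp: R_def V_def lower_edges_def upper_edges_def)
  with R have "product_form p r (V - R) (edges_of (V - R))"
    by (rule product_form_remove_initial[OF pr V F])
  moreover have "V - R = diamond i0 t0 N"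
    by (auto simp: V_def R_def diamond_def)
  ultimately show ?thesis by simp
qed

definition copy_vertex :: "int \<Rightarrow> nat \<Rightarrow> nat \<times> nat \<Rightarrow> int \<times> nat" where
  "copy_vertex i0 t0 = (\<lambda>(m, n). (i0 + int m + int n, t0 + m - n))"

lemma bij_betw_copy_vertex:
  assumes "even (i0 + int t0)" "N - 1 \<le> t0"
  shows "bij_betw (copy_vertex i0 t0) (grid_vertices N) (diamond i0 t0 N)"
\<comment> \<open>The inverse halves the diagonal coordinates; the parity of
  \<open>i0 + int t0\<close> makes them even.\<close>
proof (rule bij_betwI[where g="\<lambda>(i, t). (nat (((i - i0) + (int t - int t0)) div 2), nat (((i - i0) - (int t - int t0)) div 2))"])
  show "copy_vertex i0 t0 \<in> grid_vertices N \<rightarrow> diamond i0 t0 N"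
    using assms by (auto simp: copy_vertex_def grid_vertices_def diamond_def of_nat_diff)
  show "(\<lambda>(i, t). (nat (((i - i0) + (int t - int t0)) div 2), nat (((i - i0) - (int t - int t0)) div 2)))
      \<in> diamond i0 t0 N \<rightarrow> grid_vertices N"
    by (auto simp: grid_vertices_def diamond_def)
  fix x assume "x \<in> grid_vertices N"
  then show "(\<lambda>(i, t). (nat (((i - i0) + (int t - int t0)) div 2), nat (((i - i0) - (int t - int t0)) div 2)))
      (copy_vertex i0 t0 x) = x"
    using assms(2) by (auto simp: copy_vertex_def grid_vertices_def of_nat_diff)
next
  fix y assume "y \<in> diamond i0 t0 N"
  then obtain i t where y: "y = (i, t)" "(i, t) \<in> diamond i0 t0 N" by (cases y) auto
  have "even ((i - i0) + (int t - int t0))" "even ((i - i0) - (int t - int t0))"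
    using y(2) assms(1) by (simp_all add: diamond_def)
  then obtain m n where "(i - i0) + (int t - int t0) = 2 * m" "(i - i0) - (int t - int t0) = 2 * n"
    by (elim evenE)
  then show "copy_vertex i0 t0 ((\<lambda>(i, t). (nat (((i - i0) + (int t - int t0)) div 2), nat (((i - i0) - (int t - int t0)) div 2))) y) = y"
    using y by (auto simp: copy_vertex_def diamond_def)
qed

lemma edges_of_diamond:
  assumes "even (i0 + int t0)" "N - 1 \<le> t0"
  shows "edges_of (diamond i0 t0 N) = copy_edge i0 t0 ` grid_edges N"
proof -
  have "upper_edges (copy_vertex i0 t0 v) \<union> lower_edges (copy_vertex i0 t0 v)
      = copy_edge i0 t0 ` {left_edge v, right_edge v, bottom_edge v, top_edge v}"
    if "v \<in> grid_vertices N" for v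
    using copy_edge_vertex(2-)[OF that assms(2) prod.collapse[symmetric] refl refl, of i0]
    by (auto simp: copy_vertex_def upper_edges_def lower_edges_def split: prod.splits)
  then show ?thesis
    unfolding edges_of_def grid_edges_def
    by (simp add: bij_betw_imp_surj_on[OF bij_betw_copy_vertex[OF assms], symmetric] image_UN)
qed

text \<open>The parity of index plus time separates horizontal from vertical edges; within one kind,
  index and time give \<open>m + n\<close> and \<open>m - n\<close>, hence both coordinates.\<close>

lemma inj_on_copy_edge:
  assumes "even (i0 + int t0)" "N - 1 \<le> t0"
  shows "inj_on (copy_edge i0 t0) (grid_edges N)"
proof -
  \<comment> \<open>On grid edges the natural subtraction in \<open>copy_edge\<close> does not
    truncate, since \<open>N - 1 \<le> t0\<close>.\<close>
  have time: "int (snd (copy_edge i0 t0 g))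
      = (case g of Hor m n \<Rightarrow> int t0 + int m - int n | Ver m n \<Rightarrow> int t0 + 1 + int m - int n)"
    if "g \<in> grid_edges N" for g
  proof -
    have "(case g of Hor m n \<Rightarrow> n \<le> t0 | Ver m n \<Rightarrow> n \<le> t0 + 1)"
      using that assms(2)
      by (auto simp: grid_edges_def grid_vertices_def left_edge_def right_edge_def bottom_edge_def top_edge_def)
    then show ?thesis by (cases g) (simp_all add: of_nat_diff)
  qed
  show ?thesis
  proof (rule inj_onI)
    fix g h assume "g \<in> grid_edges N" "h \<in> grid_edges N" and eq: "copy_edge i0 t0 g = copy_edge i0 t0 h"
    then have snd: "int (snd (copy_edge i0 t0 g)) = int (snd (copy_edge i0 t0 h))" by simp
    have fst: "fst (copy_edge i0 t0 g) = fst (copy_edge i0 t0 h)" by (simp add: eq)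
    show "g = h"
      using fst snd unfolding time[OF \<open>g \<in> grid_edges N\<close>] time[OF \<open>h \<in> grid_edges N\<close>]
      by (cases g; cases h; simp; presburger)
  qed
qed

section \<open>Eight-vertex weights as transition probabilities\<close>

lemma finite_grid_edges [simp]: "finite (grid_edges N)"
  by (simp add: grid_edges_def grid_vertices_def)

lemma finite_grid_orientations [simp]: "finite (grid_orientations N)"
  by (simp add: grid_orientations_def finite_PiE)

text \<open>After rotation the left and top edges are the input and the bottom and right edges the
  output, with horizontal bits negated. Unequal inputs are swapped for weight \<open>a\<close> and
  kept for \<open>c\<close>; equal inputs are kept for \<open>b\<close> and flipped for
  \<open>d\<close>. Since \<open>a + c = b + d\<close>, one normalization serves both cases.\<close>

lemma local_weight_eq_vertex_pmf:
  assumes "a \<ge> 0" "b \<ge> 0" "c \<ge> 0" "d \<ge> 0" "a + c > 0" "a + c = b + d"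
  shows "local_weight a b c d \<theta> v = (a + c) *
    pmf (vertex_pmf (a / (a + c)) (b / (b + d)) (\<not> \<theta> (left_edge v)) (\<theta> (top_edge v)))
      (\<theta> (bottom_edge v), \<not> \<theta> (right_edge v))"
proof -
  have "(a + c) * (a / (a + c)) = a" "(a + c) * (b / (b + d)) = b"
    "(a + c) * (1 - a / (a + c)) = c" "(a + c) * (1 - b / (b + d)) = d"
    using assms by (simp_all add: right_diff_distrib)
  moreover have "0 \<le> a / (a + c)" "a / (a + c) \<le> 1" "0 \<le> b / (b + d)" "b / (b + d) \<le> 1"
    using assms by simp_all
  ultimately show ?thesis
    by (cases "\<theta> (left_edge v)"; cases "\<theta> (right_edge v)"; cases "\<theta> (bottom_edge v)"; cases "\<theta> (top_edge v)")
       (simp_all add: local_weight_def pmf_vertex_pmf)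
qed

text \<open>An odd vertex falls into the last branch of \<open>local_weight\<close>. This lets sums
  over \<open>Omega8 N\<close> range over all orientations of the grid.\<close>

lemma weight_eq_0:
  assumes "\<theta> \<in> grid_orientations N" "\<theta> \<notin> Omega8 N"
  shows "weight a b c d N \<theta> = 0"
proof -
  obtain v where v: "v \<in> grid_vertices N" "odd (in_degree \<theta> v)"
    using assms by (auto simp: Omega8_def)
  then have "local_weight a b c d \<theta> v = 0"
    by (cases "\<theta> (left_edge v)"; cases "\<theta> (right_edge v)"; cases "\<theta> (bottom_edge v)"; cases "\<theta> (top_edge v)")
       (simp_all add: local_weight_def in_degree_def)
  with v show ?thesis
    unfolding weight_def by (intro prod_zero) (auto simp: grid_vertices_def)
qed

lemma vertex_weight_copy_vertex:
  assumes v: "v \<in> grid_vertices N" "N - 1 \<le> t0"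
    and \<eta>: "\<And>g. g \<in> grid_edges N \<Longrightarrow> \<eta> (copy_edge i0 t0 g) = (case g of Hor m n \<Rightarrow> \<not> \<theta> g | Ver m n \<Rightarrow> \<theta> g)"
  shows "vertex_weight p r \<eta> (copy_vertex i0 t0 v) =
    pmf (vertex_pmf p r (\<not> \<theta> (left_edge v)) (\<theta> (top_edge v))) (\<theta> (bottom_edge v), \<not> \<theta> (right_edge v))"
proof -
  obtain m n where mn: "v = (m, n)" by (cases v)
  have "left_edge v \<in> grid_edges N" "right_edge v \<in> grid_edges N"
    "bottom_edge v \<in> grid_edges N" "top_edge v \<in> grid_edges N"
    using v(1) unfolding grid_edges_def by blast+
  note [simp] = this[THEN \<eta>]
  note edge = copy_edge_vertex(2-)[OF v mn refl refl, of i0]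
  have "\<eta> (i0 + int m + int n, t0 + m - n) = (\<not> \<theta> (left_edge v))"
    "\<eta> (i0 + int m + int n + 1, t0 + m - n) = \<theta> (top_edge v)"
    "\<eta> (i0 + int m + int n, t0 + m - n + 1) = \<theta> (bottom_edge v)"
    "\<eta> (i0 + int m + int n + 1, t0 + m - n + 1) = (\<not> \<theta> (right_edge v))"
    unfolding edge[symmetric]
    by (simp_all, simp_all add: mn left_edge_def right_edge_def bottom_edge_def top_edge_def)
  then show ?thesis
    by (simp add: vertex_weight_def copy_vertex_def mn)
qed

text \<open>Proportionality to the weight is enough: the constant \<open>C\<close> is fixed
  afterwards by total mass one.\<close>

lemma measure_chain_law_rotated_restriction:
  fixes a b c d :: real
  assumes abcd: "a \<ge> 0" "b \<ge> 0" "c \<ge> 0" "d \<ge> 0" "a + c > 0" "a + c = b + d"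
    and copy: "even (i0 + int t0)" "N - 1 \<le> t0"
  obtains C where "\<And>\<theta>. \<theta> \<in> grid_orientations N \<Longrightarrow> {e. rotated_restriction i0 t0 N e = \<theta>} \<in> sets orientation_space"
    and "\<And>\<theta>. \<theta> \<in> grid_orientations N \<Longrightarrow>
      measure (chain_law (PM (1/2)) (a / (a + c)) (b / (b + d))) {e. rotated_restriction i0 t0 N e = \<theta>}
        = C * weight a b c d N \<theta>"
proof -
  let ?D = "diamond i0 t0 N" and ?p = "a / (a + c)" and ?r = "b / (b + d)"
  \<comment> \<open>One factor 1/2 for each free edge of the copy, and one division by
    \<open>a + c\<close> for each vertex.\<close>
  define C where "C = (1/2) ^ card (edges_of ?D - \<Union>(lower_edges ` ?D)) / (a + c) ^ card (grid_vertices N)"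
  have pr: "0 \<le> ?p" "?p \<le> 1" "0 \<le> ?r" "?r \<le> 1"
    using abcd by simp_all
  have event: "\<exists>\<eta>. {e. rotated_restriction i0 t0 N e = \<theta>} = cylinder (edges_of ?D) \<eta> \<and>
      (\<forall>g\<in>grid_edges N. \<eta> (copy_edge i0 t0 g) = (case g of Hor m n \<Rightarrow> \<not> \<theta> g | Ver m n \<Rightarrow> \<theta> g))"
    if "\<theta> \<in> grid_orientations N" for \<theta>
  proof -
    \<comment> \<open>\<theta> is carried to the infinite graph along the inverse of
      \<open>copy_edge\<close>. Off the copy the value is unspecified, and the cylinder reads only
      edges of the copy.\<close>
    define \<eta> where "\<eta> x = (let g = the_inv_into (grid_edges N) (copy_edge i0 t0) x in
      case g of Hor m n \<Rightarrow> \<not> \<theta> g | Ver m n \<Rightarrow> \<theta> g)" for x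
    have \<eta>: "\<eta> (copy_edge i0 t0 g) = (case g of Hor m n \<Rightarrow> \<not> \<theta> g | Ver m n \<Rightarrow> \<theta> g)" if "g \<in> grid_edges N" for g
      using that by (simp add: \<eta>_def the_inv_into_f_f[OF inj_on_copy_edge[OF copy]])
    have "e \<in> {e. rotated_restriction i0 t0 N e = \<theta>} \<longleftrightarrow> e \<in> cylinder (edges_of ?D) \<eta>" for e
    proof -
      have "rotated_restriction i0 t0 N e \<in> grid_orientations N"
        by (simp add: grid_orientations_def rotated_restriction_def)
      \<comment> \<open>Both sides are extensional, so equality need only be tested on the grid
        edges.\<close>
      then have "rotated_restriction i0 t0 N e = \<theta> \<longleftrightarrow>
          (\<forall>g\<in>grid_edges N. rotated_restriction i0 t0 N e g = \<theta> g)"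
        using that unfolding grid_orientations_def by (auto intro: PiE_ext)
      also have "\<dots> \<longleftrightarrow> (\<forall>g\<in>grid_edges N. e (copy_edge i0 t0 g) = \<eta> (copy_edge i0 t0 g))"
        by (rule ball_cong) (auto simp: \<eta> rotated_restriction_def split: grid_edge.splits)
      finally show ?thesis
        by (simp add: cylinder_def edges_of_diamond[OF copy])
    qed
    then have "{e. rotated_restriction i0 t0 N e = \<theta>} = cylinder (edges_of ?D) \<eta>"
      by (rule set_eqI)
    with \<eta> show ?thesis by blast
  qed
  have fin: "finite (edges_of ?D)"
    by (simp add: edges_of_diamond[OF copy])
  show thesis
  proof (rule that)
    fix \<theta> assume \<theta>: "\<theta> \<in> grid_orientations N"
    from event[OF \<theta>] obtain \<eta> where ev: "{e. rotated_restriction i0 t0 N e = \<theta>} = cylinder (edges_of ?D) \<eta>"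
      and \<eta>: "\<And>g. g \<in> grid_edges N \<Longrightarrow> \<eta> (copy_edge i0 t0 g) = (case g of Hor m n \<Rightarrow> \<not> \<theta> g | Ver m n \<Rightarrow> \<theta> g)"
      by blast
    show "{e. rotated_restriction i0 t0 N e = \<theta>} \<in> sets orientation_space"
      unfolding ev using fin by (rule sets_cylinder_orientation)
    have "(\<Prod>v\<in>?D. vertex_weight ?p ?r \<eta> v) = (\<Prod>v\<in>grid_vertices N. vertex_weight ?p ?r \<eta> (copy_vertex i0 t0 v))"
      by (rule prod.reindex_bij_betw[OF bij_betw_copy_vertex[OF copy], symmetric])
    also have "\<dots> = (\<Prod>v\<in>grid_vertices N. local_weight a b c d \<theta> v / (a + c))"
    proof (rule prod.cong[OF refl])
      fix v assume v: "v \<in> grid_vertices N"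
      have "vertex_weight ?p ?r \<eta> (copy_vertex i0 t0 v)
          = pmf (vertex_pmf ?p ?r (\<not> \<theta> (left_edge v)) (\<theta> (top_edge v))) (\<theta> (bottom_edge v), \<not> \<theta> (right_edge v))"
        by (rule vertex_weight_copy_vertex[OF v copy(2)]) (rule \<eta>)
      then show "vertex_weight ?p ?r \<eta> (copy_vertex i0 t0 v) = local_weight a b c d \<theta> v / (a + c)"
        unfolding local_weight_eq_vertex_pmf[OF abcd] using abcd(5) by simp
    qed
    also have "\<dots> = weight a b c d N \<theta> / (a + c) ^ card (grid_vertices N)"
      by (simp add: weight_def prod_dividef)
    finally show "measure (chain_law (PM (1/2)) ?p ?r) {e. rotated_restriction i0 t0 N e = \<theta>} = C * weight a b c d N \<theta>"
      using product_form_diamond[OF pr, of i0 t0 N] by (simp add: ev product_form_def C_def)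
  qed
qed

theorem proposition1p4:
  fixes a b c d :: real
    and M :: "'w measure" and e :: "'w \<Rightarrow> int \<times> nat \<Rightarrow> bool"
    and N t0 :: nat and i0 :: int
  assumes "a \<ge> 0" and "b \<ge> 0" and "c \<ge> 0" and "d \<ge> 0"
    and "\<not> (a = 0 \<and> b = 0 \<and> c = 0 \<and> d = 0)"
    and "a + c = b + d"
    and "prob_space M"
    and "e \<in> measurable M orientation_space"
    and "distr M orientation_space e = chain_law (PM (1/2)) (a / (a + c)) (b / (b + d))"
    and "N \<ge> 1"
    and "even (i0 + int t0)" and "t0 \<ge> N - 1"
  shows "distr M (count_space (grid_orientations N)) (\<lambda>\<omega>. rotated_restriction i0 t0 N (e \<omega>))
           = P8 a b c d N"
proof -
  let ?G = "grid_orientations N" and ?f = "\<lambda>\<omega>. rotated_restriction i0 t0 N (e \<omega>)"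
  interpret prob_space M by fact
  note e = \<open>e \<in> measurable M orientation_space\<close>
  have "a + c > 0"
    using assms(1-6) by linarith
  obtain C where sets: "\<And>\<theta>. \<theta> \<in> ?G \<Longrightarrow> {e. rotated_restriction i0 t0 N e = \<theta>} \<in> sets orientation_space"
    and C: "\<And>\<theta>. \<theta> \<in> ?G \<Longrightarrow>
      measure (distr M orientation_space e) {e. rotated_restriction i0 t0 N e = \<theta>} = C * weight a b c d N \<theta>"
    unfolding \<open>distr M orientation_space e = _\<close>
    by (rule measure_chain_law_rotated_restriction[OF assms(1-4) \<open>a + c > 0\<close> assms(6,11,12)]) blast
  have vimage: "?f -` {\<theta>} \<inter> space M = e -` {e. rotated_restriction i0 t0 N e = \<theta>} \<inter> space M" for \<theta>
    by auto
  have f: "?f \<in> measurable M (count_space ?G)"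
    using measurable_sets[OF e sets]
    by (simp add: measurable_count_space_eq2 vimage) (simp add: grid_orientations_def rotated_restriction_def)
  have prob: "measure (distr M (count_space ?G) ?f) {\<theta>} = C * weight a b c d N \<theta>" if "\<theta> \<in> ?G" for \<theta>
    using C[OF that] that by (simp add: measure_distr[OF f] measure_distr[OF e sets] vimage)
  interpret D: prob_space "distr M (count_space ?G) ?f"
    by (rule prob_space_distr[OF f])
  \<comment> \<open>Total mass one determines \<open>C\<close>.\<close>
  have "1 = (\<Sum>\<theta>\<in>?G. measure (distr M (count_space ?G) ?f) {\<theta>})"
    using D.prob_space D.finite_measure_eq_sum_singleton[of ?G] by simp
  also have "\<dots> = C * (\<Sum>\<theta>\<in>?G. weight a b c d N \<theta>)"
    by (simp add: prob sum_distrib_left)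
  also have "(\<Sum>\<theta>\<in>?G. weight a b c d N \<theta>) = (\<Sum>\<theta>\<in>Omega8 N. weight a b c d N \<theta>)"
    by (intro sum.mono_neutral_right) (auto simp: Omega8_def intro: weight_eq_0)
  \<comment> \<open>A product equal to 1 also shows that the partition function is nonzero.\<close>
  finally have C_eq: "C = 1 / (\<Sum>\<theta>\<in>Omega8 N. weight a b c d N \<theta>)"
    by (metis eq_divide_eq mult_zero_right zero_neq_one)
  have prob_eq: "measure (distr M (count_space ?G) ?f) {\<theta>}
      = (if \<theta> \<in> Omega8 N then weight a b c d N \<theta> / (\<Sum>\<theta>'\<in>Omega8 N. weight a b c d N \<theta>') else 0)"
    if "\<theta> \<in> ?G" for \<theta>
    using weight_eq_0[OF that] by (simp add: prob[OF that] C_eq)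
  show ?thesis
  proof (rule measure_eqI_finite[where A="?G"])
    fix \<theta> assume "\<theta> \<in> ?G"
    then show "emeasure (distr M (count_space ?G) ?f) {\<theta>} = emeasure (P8 a b c d N) {\<theta>}"
      unfolding P8_def by (simp add: D.emeasure_eq_measure prob_eq emeasure_point_measure_finite)
  qed (simp_all add: P8_def sets_point_measure)
qed

end
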